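(* Let $\phi:\mathbb{R}^n_{\geq0}\to\mathbb{R}$ be a measurable, bounded, rapidly decreasing function, and let $p$ be a polynomial which is completely non-vanishing on $\mathbb{R}^n_+$. Then the Mellin transform $$\mathcal M_{\phi/p}(\boldsymbol s)=\int_{\mathbb{R}^n_+}\frac{\boldsymbol\epsilon^{\boldsymbol s-1}\phi(\boldsymbol\epsilon)}{p(\boldsymbol\epsilon)}\,d\boldsymbol\epsilon$$ converges absolutely and defines an analytic function of $\boldsymbol s$ on the tube domain $\{\boldsymbol s\in\mathbb{C}^n:\Re(\boldsymbol s)\in\Delta_p+\mathbb{R}^n_+\}$.
   Context: $\mathbb{R}^n_+=(0,\infty)^n$, $\mathbb{R}^n_{\geq0}=[0,\infty)^n$, $\boldsymbol\epsilon^{\boldsymbol s-1}=\prod_i\epsilon_i^{s_i-1}$. A function $\phi$ on $\mathbb{R}^n_{\geq0}$ is rapidly decreasing if $\boldsymbol\epsilon^\alpha\phi(\boldsymbol\epsilon)\to0$ as $\boldsymbol\epsilon\to\infty$ for every $\alpha\in\mathbb{Z}^n$. For $p(\boldsymbol\epsilon)=\sum_{\alpha\in\mathcal A}a_\alpha\boldsymbol\epsilon^\alpha$ ($\mathcal A$ finite, $a_\alpha\ne0$), the Newton polytope $\Delta_p$ is the convex hull of $\mathcal A$; for a face $\Gamma$ of $\Delta_p$ the truncated polynomial $p_\Gamma$ is the sum of the monomials of $p$ whose exponents lie in $\Gamma$. $p$ is completely non-vanishing on $\mathcal O\subset\mathbb{C}^n$ if neither $p$ nor any of its truncated polynomials vanishes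 on $\mathcal O$. $\Delta_p+\mathbb{R}^n_+$ is a Minkowski sum. *)

theory Defs
  imports "HOL-Analysis.Analysis" "HOL-Library.Poly_Mapping"
begin

definition pos_orthant :: "(real^'n) set" where
  "pos_orthant = {x. \<forall>i. 0 < x $ i}"

definition nonneg_orthant :: "(real^'n) set" where
  "nonneg_orthant = {x. \<forall>i. 0 \<le> x $ i}"

definition cvec :: "real^'n \<Rightarrow> complex^'n" where
  "cvec x = (\<chi> i. complex_of_real (x $ i))"

definition Re_vec :: "complex^'n \<Rightarrow> real^'n" where
  "Re_vec s = (\<chi> i. Re (s $ i))"

text \<open>
  The limit is taken as the norm of \<open>x\<close> tends to infinity inside the closed orthant. At a boundary
  point where a negative power of \<open>0\<close> occurs the monomial is undefined; there \<open>0 powi k = 0\<close>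
  makes the expression \<open>0\<close>, so that such points impose no condition.
\<close>
definition rapidly_decreasing :: "(real^'n \<Rightarrow> real) \<Rightarrow> bool" where
  "rapidly_decreasing \<phi> \<longleftrightarrow>
     (\<forall>\<alpha> :: int^'n.
        ((\<lambda>x. (\<Prod>i\<in>UNIV. (x $ i) powi (\<alpha> $ i)) * \<phi> x) \<longlongrightarrow> 0)
          (inf at_infinity (principal nonneg_orthant)))"

text \<open>
  A polynomial in the variables indexed by \<open>'n\<close> is a finitely supported family of complex
  coefficients indexed by exponent vectors; \<open>Poly_Mapping.keys p\<close> is the set of exponents
  whose coefficient is nonzero.
\<close>
type_synonym 'n polynomial = "(nat^'n) \<Rightarrow>\<^sub>0 complex"

definition eval_poly :: "'n::finite polynomial \<Rightarrow> complex^'n \<Rightarrow> complex" where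
  "eval_poly p z = (\<Sum>\<alpha>\<in>Poly_Mapping.keys p.
     Poly_Mapping.lookup p \<alpha> * (\<Prod>i\<in>UNIV. (z $ i) ^ (\<alpha> $ i)))"

definition exponent_vec :: "nat^'n \<Rightarrow> real^'n" where
  "exponent_vec \<alpha> = (\<chi> i. real (\<alpha> $ i))"

definition newton_polytope :: "'n::finite polynomial \<Rightarrow> (real^'n) set" where
  "newton_polytope p = convex hull (exponent_vec ` Poly_Mapping.keys p)"

definition truncated_poly :: "(real^'n) set \<Rightarrow> 'n::finite polynomial \<Rightarrow> 'n polynomial" where
  "truncated_poly \<Gamma> p =
     (\<Sum>\<alpha> | \<alpha> \<in> Poly_Mapping.keys p \<and> exponent_vec \<alpha> \<in> \<Gamma>.
        Poly_Mapping.single \<alpha> (Poly_Mapping.lookup p \<alpha>))"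

text \<open>
  The empty set satisfies \<open>face_of\<close> but has to be excluded: its truncated polynomial is \<open>0\<close>, so
  that no polynomial would be completely non-vanishing on a nonempty set.
\<close>
definition completely_nonvanishing_on :: "'n::finite polynomial \<Rightarrow> (complex^'n) set \<Rightarrow> bool" where
  "completely_nonvanishing_on p U \<longleftrightarrow>
     (\<forall>z\<in>U. eval_poly p z \<noteq> 0) \<and>
     (\<forall>\<Gamma>. \<Gamma> face_of newton_polytope p \<and> \<Gamma> \<noteq> {} \<longrightarrow>
        (\<forall>z\<in>U. eval_poly (truncated_poly \<Gamma> p) z \<noteq> 0))"

definition mellin_integrand ::
    "(real^'n \<Rightarrow> complex) \<Rightarrow> complex^'n \<Rightarrow> real^'n \<Rightarrow> complex" where
  "mellin_integrand f s x = (\<Prod>i\<in>UNIV. complex_of_real (x $ i) powr (s $ i - 1)) * f x"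

definition mellin_transform :: "(real^'n \<Rightarrow> complex) \<Rightarrow> complex^'n \<Rightarrow> complex" where
  "mellin_transform f s = (LINT x:pos_orthant|lebesgue. mellin_integrand f s x)"

definition tube_domain :: "(real^'n) set \<Rightarrow> (complex^'n) set" where
  "tube_domain B = {s. Re_vec s \<in> B}"

text \<open>
  Analyticity in several complex variables: near every point of \<open>U\<close> the function is the
  (unconditionally, hence absolutely) convergent sum of a power series.
\<close>
definition multi_analytic_on :: "(complex^'n \<Rightarrow> complex) \<Rightarrow> (complex^'n) set \<Rightarrow> bool" where
  "multi_analytic_on f U \<longleftrightarrow>
     (\<forall>a\<in>U. \<exists>r>0. \<exists>c :: nat^'n \<Rightarrow> complex. \<forall>z\<in>ball a r.
        ((\<lambda>\<alpha>. c \<alpha> * (\<Prod>i\<in>UNIV. (z $ i - a $ i) ^ (\<alpha> $ i))) has_sum f z) UNIV)"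

end

theory Submission
  imports Defs
begin

text \<open>
  Non-vanishing of the face polynomials gives a lower bound \<open>\<delta> * x\<^sup>v \<le> |p(x)|\<close> on the positive orthant,
  uniformly in \<open>v\<close> in the Newton polytope. If \<open>Re s = v + w\<close> with all \<open>w\<^sub>i > r > 0\<close>, the integrand times
  \<open>\<Prod>\<^sub>i exp (r * |ln x\<^sub>i|)\<close> is therefore dominated by a product of integrable functions of one variable: near
  \<open>0\<close> by \<open>t\<close> to the power \<open>w\<^sub>i - r - 1\<close>, near infinity by the rapid decrease of \<open>\<phi>\<close>. Writing \<open>x\<^sub>i\<close> to the power
  \<open>z\<^sub>i - s\<^sub>i\<close> as \<open>exp ((z\<^sub>i - s\<^sub>i) * ln x\<^sub>i)\<close>, expanding and integrating termwise then gives the power series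
  at \<open>s\<close>.
\<close>

section \<open>Lower bounds for exponential sums by compactness\<close>

text \<open>Bolzano-Weierstrass is applied to one member of the family at a time; each further
  thinning of the subsequence keeps the limits already obtained.\<close>

lemma finite_family_convergent_subsequence:
  fixes f :: "'a \<Rightarrow> nat \<Rightarrow> real"
  assumes "finite A" "\<And>a. a \<in> A \<Longrightarrow> bounded (range (f a))"
  shows "\<exists>l r. strict_mono r \<and> (\<forall>a\<in>A. (f a \<circ> r) \<longlonglongrightarrow> l a)"
  using assms
proof (induction A rule: finite_induct)
  case empty
  then show ?case by (auto intro: exI[of _ id] simp: strict_mono_id)
next
  case (insert b A)
  then obtain l r where r: "strict_mono r" "\<forall>a\<in>A. (f a \<circ> r) \<longlonglongrightarrow> l a"
    by (metis insertI2)
  have "bounded (range (f b \<circ> r))"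
    using insert.prems[of b] by (auto intro: bounded_subset)
  then obtain l' r' where r': "strict_mono r'" "((f b \<circ> r) \<circ> r') \<longlonglongrightarrow> l'"
    using bounded_imp_convergent_subsequence by blast
  have "strict_mono (r \<circ> r')" using r r' by (simp add: strict_mono_o)
  moreover have "(f a \<circ> (r \<circ> r')) \<longlonglongrightarrow> (l(b := l')) a" if "a \<in> insert b A" for a
  proof (cases "a = b")
    case True then show ?thesis using r' by (simp add: o_assoc)
  next
    case False
    then have "((f a \<circ> r) \<circ> r') \<longlonglongrightarrow> l a"
      using that r(2) r'(1) by (intro LIMSEQ_subseq_LIMSEQ[of "f a \<circ> r"]) auto
    then show ?thesis using False by (simp add: o_assoc)
  qed
  ultimately show ?case by blast
qed

text \<open>The sequence \<open>y\<close> may diverge, but only in directions orthogonal to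
  \<open>D\<close>: its orthogonal projection to the span of \<open>D\<close> has convergent
  coordinates in an orthonormal basis. The lemma replaces \<open>y\<close> by a convergent sequence
  that the vectors of \<open>D\<close> cannot tell apart from it.\<close>

lemma convergent_inner_span:
  fixes D :: "'a::euclidean_space set" and y :: "nat \<Rightarrow> 'a"
  assumes D: "\<And>d. d \<in> D \<Longrightarrow> convergent (\<lambda>k. d \<bullet> y k)"
  obtains P z where "\<forall>d\<in>D. \<forall>k. d \<bullet> P k = d \<bullet> y k" and "P \<longlonglongrightarrow> z"
proof -
  obtain B where B: "B \<subseteq> span D" "pairwise orthogonal B" "\<And>x. x \<in> B \<Longrightarrow> norm x = 1"
    "independent B" "span B = span D"
    using orthonormal_basis_subspace[OF subspace_span[of D]] by metis
  have fin: "finite B" using B independent_imp_finite by blast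
  have conv: "convergent (\<lambda>k. d \<bullet> y k)" if "d \<in> span D" for d
    using that
  proof (induction rule: span_induct_alt)
    case base
    then show ?case by (simp add: convergent_const)
  next
    case (step c x w)
    then show ?case
      using convergent_add[OF convergent_mult[OF convergent_const[of c] D[of x]] step(2)]
      by (simp add: inner_add_left)
  qed
  \<comment> \<open>The orthogonal projection of \<open>y k\<close> onto
    \<open>span D\<close>.\<close>
  define P where "P k = (\<Sum>b\<in>B. (b \<bullet> y k) *\<^sub>R b)" for k
  have bb: "b \<bullet> b' = (if b = b' then 1 else 0)" if "b \<in> B" "b' \<in> B" for b b'
    using B(2) B(3)[of b] that by (auto simp: pairwise_def orthogonal_def norm_eq_1)
  have PB: "b \<bullet> P k = b \<bullet> y k" if "b \<in> B" for b k
  proof -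
    have "b \<bullet> P k = (\<Sum>b'\<in>B. if b = b' then b' \<bullet> y k else 0)"
      unfolding P_def inner_sum_right using that by (intro sum.cong) (auto simp: bb)
    then show ?thesis using fin that by simp
  qed
  have PD: "d \<bullet> P k = d \<bullet> y k" if "d \<in> D" for d k
  proof -
    have "d \<in> span B" using that B by (simp add: span_base)
    then show ?thesis
      by (induction rule: span_induct_alt) (auto simp: inner_add_left PB)
  qed
  have "P \<longlonglongrightarrow> (\<Sum>b\<in>B. lim (\<lambda>k. b \<bullet> y k) *\<^sub>R b)"
    unfolding P_def
    by (intro tendsto_sum tendsto_scaleR tendsto_const) (use conv B(1) convergent_LIMSEQ_iff in blast)
  with PD show thesis using that by blast
qed

text \<open>
  Compactness of the toric variety attached to \<open>A\<close>: if the bound fails along a sequence \<open>y\<close>, the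
  normalised weights of the monomials converge along a subsequence, the limit weights are supported
  on the exponents in a face, and they are proportional to the monomials at a point of the torus.
\<close>
lemma exponential_sum_lower_bound:
  fixes A :: "'a::euclidean_space set" and c :: "'a \<Rightarrow> complex"
  assumes fin: "finite A" and ne: "A \<noteq> {}"
    and nz: "\<And>F y. F face_of convex hull A \<Longrightarrow> F \<noteq> {} \<Longrightarrow>
               (\<Sum>a\<in>A \<inter> F. c a * of_real (exp (a \<bullet> y))) \<noteq> 0"
  obtains \<delta> where "\<delta> > 0"
    "\<And>y. \<delta> * (\<Sum>a\<in>A. exp (a \<bullet> y)) \<le> norm (\<Sum>a\<in>A. c a * of_real (exp (a \<bullet> y)))"
proof (rule ccontr)
  assume "\<not> thesis"
  define Z where "Z y = (\<Sum>a\<in>A. exp (a \<bullet> y))" for y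
  define q where "q y = (\<Sum>a\<in>A. c a * of_real (exp (a \<bullet> y)))" for y
  have "\<exists>y. norm (q y) < 1 / real (Suc k) * Z y" for k
    using that[of "1 / real (Suc k)"] \<open>\<not> thesis\<close>
    unfolding q_def Z_def by (metis not_le_imp_less of_nat_0_less_iff zero_less_Suc zero_less_divide_1_iff)
  then obtain y where y: "\<And>k. norm (q (y k)) < 1 / real (Suc k) * Z (y k)" by metis
  have Zpos: "Z v > 0" for v unfolding Z_def using fin ne by (intro sum_pos) auto
  define w where "w a k = exp (a \<bullet> y k) / Z (y k)" for a k
  have w1: "(\<Sum>a\<in>A. w a k) = 1" for k
    using Zpos[of "y k"] by (simp add: w_def flip: sum_divide_distrib Z_def)
  have wpos: "w a k > 0" for a k using Zpos by (simp add: w_def)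
  have wle: "w a k \<le> 1" if "a \<in> A" for a k
    using member_le_sum[of a A "\<lambda>a. w a k"] that fin wpos w1 by (simp add: less_imp_le)
  have wb: "bounded (range (w a))" if "a \<in> A" for a
    unfolding bounded_iff using wle[OF that] wpos[of a]
    by (intro exI[of _ 1]) (auto simp: abs_of_pos)
  obtain l r where r: "strict_mono r" "\<And>a. a \<in> A \<Longrightarrow> (w a \<circ> r) \<longlonglongrightarrow> l a"
    using finite_family_convergent_subsequence[of A w, OF fin wb] by metis
  have wl: "(\<lambda>k. w a (r k)) \<longlonglongrightarrow> l a" if "a \<in> A" for a using r(2)[OF that] by (simp add: o_def)
  have l0: "l a \<ge> 0" if "a \<in> A" for a
    using wl[OF that] wpos by (intro LIMSEQ_le_const[of _ "l a"]) (auto intro: less_imp_le)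
  have "(\<lambda>k. \<Sum>a\<in>A. w a (r k)) \<longlonglongrightarrow> (\<Sum>a\<in>A. l a)" by (intro tendsto_sum wl)
  then have l1: "(\<Sum>a\<in>A. l a) = 1" by (simp add: w1 LIMSEQ_const_iff)
  define S where "S = {a\<in>A. l a > 0}"
  have SA: "S \<subseteq> A" "finite S" using fin by (auto simp: S_def)
  have "S \<noteq> {}"
  proof
    assume "S = {}"
    then have "l a = 0" if "a \<in> A" for a using l0[OF that] that by (auto simp: S_def)
    then show False using l1 by simp
  qed
  \<comment> \<open>A reference exponent of positive limit weight: dividing by its weight cancels
    \<open>Z\<close> and leaves exponentials of the linear forms \<open>a - a0\<close>.\<close>
  then obtain a0 where a0: "a0 \<in> S" by auto
  have la0: "l a0 > 0" "a0 \<in> A" using a0 by (auto simp: S_def)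
  have ratio: "(\<lambda>k. exp ((a - a0) \<bullet> y (r k))) \<longlonglongrightarrow> l a / l a0" if "a \<in> A" for a
  proof -
    have "exp ((a - a0) \<bullet> y (r k)) = w a (r k) / w a0 (r k)" for k
      using Zpos[of "y (r k)"] by (simp add: w_def inner_diff_left exp_diff)
    then show ?thesis using tendsto_divide[OF wl[OF that] wl[OF la0(2)]] la0 by simp
  qed
  \<comment> \<open>On \<open>S\<close> the limit ratio is positive, so logarithms give finite
    limits of these linear forms.\<close>
  have lim: "(\<lambda>k. (a - a0) \<bullet> y (r k)) \<longlonglongrightarrow> ln (l a / l a0)" if "a \<in> S" for a
    using tendsto_ln[OF ratio[of a]] that la0 by (auto simp: S_def)
  have "convergent (\<lambda>k. d \<bullet> y (r k))" if "d \<in> (\<lambda>a. a - a0) ` S" for d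
    using that lim by (auto simp: convergent_def)
  then obtain P z where
    P: "\<forall>d\<in>(\<lambda>a. a - a0) ` S. \<forall>k. d \<bullet> P k = d \<bullet> y (r k)" and z: "P \<longlonglongrightarrow> z"
    by (rule convergent_inner_span)
  have lz: "l a = l a0 * exp ((a - a0) \<bullet> z)" if "a \<in> S" for a
  proof -
    have "(\<lambda>k. exp ((a - a0) \<bullet> P k)) \<longlonglongrightarrow> exp ((a - a0) \<bullet> z)"
      by (intro tendsto_exp tendsto_inner tendsto_const z)
    moreover have "exp ((a - a0) \<bullet> P k) = exp ((a - a0) \<bullet> y (r k))" for k
      using P that by auto
    ultimately have "exp ((a - a0) \<bullet> z) = l a / l a0"
      using ratio[of a] that LIMSEQ_unique by (force simp: S_def)
    then show ?thesis using la0 by (simp add: field_simps)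
  qed
  \<comment> \<open>The weight of \<open>b\<close> relative to \<open>a0\<close> tends to 0. Since
    \<open>P\<close> converges, removing it from \<open>y (r k)\<close> changes this ratio by a
    factor with a positive limit, so the ratio still falls below 1.\<close>
  have "\<forall>\<^sub>F k in sequentially. (b - a0) \<bullet> (y (r k) - P k) < 0" if "b \<in> A - S" for b
  proof -
    have "l b = 0" using that l0[of b] by (auto simp: S_def)
    then have "(\<lambda>k. exp ((b - a0) \<bullet> y (r k)) * exp (- ((b - a0) \<bullet> P k)))
        \<longlonglongrightarrow> 0 * exp (- ((b - a0) \<bullet> z))"
      using ratio[of b] that by (intro tendsto_intros z) auto
    then have "(\<lambda>k. exp ((b - a0) \<bullet> (y (r k) - P k))) \<longlonglongrightarrow> 0"
      by (simp add: inner_diff_right exp_diff exp_minus divide_inverse)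
    then have "\<forall>\<^sub>F k in sequentially. exp ((b - a0) \<bullet> (y (r k) - P k)) < 1"
      by (rule order_tendstoD) simp
    then show ?thesis by simp
  qed
  then have "\<forall>\<^sub>F k in sequentially. \<forall>b\<in>A - S. (b - a0) \<bullet> (y (r k) - P k) < 0"
    using fin by (intro eventually_ball_finite) auto
  from eventually_happens'[OF sequentially_bot this]
  obtain k where k: "\<forall>b\<in>A - S. (b - a0) \<bullet> (y (r k) - P k) < 0" ..
  \<comment> \<open>A single such \<open>k\<close> suffices: \<open>u\<close> is orthogonal to
    \<open>a - a0\<close> for \<open>a \<in> S\<close> and has negative inner product with
    \<open>b - a0\<close> for the other exponents. Hence a supporting hyperplane with normal
    \<open>u\<close> cuts out a face whose exponents are exactly \<open>S\<close>.\<close>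
  define u where "u = y (r k) - P k"
  have uS: "u \<bullet> a = u \<bullet> a0" if "a \<in> S" for a
  proof -
    have "(a - a0) \<bullet> P k = (a - a0) \<bullet> y (r k)" using P that by blast
    then show ?thesis by (simp add: u_def inner_diff_left inner_diff_right inner_commute)
  qed
  have uN: "u \<bullet> b < u \<bullet> a0" if "b \<in> A - S" for b
  proof -
    have "(b - a0) \<bullet> u < 0" using k that unfolding u_def by blast
    then show ?thesis by (simp add: inner_diff_left inner_commute[of u])
  qed
  have "u \<bullet> a \<le> u \<bullet> a0" if "a \<in> A" for a
    using uS[of a] uN[of a] that by force
  then have "convex hull A \<subseteq> {x. u \<bullet> x \<le> u \<bullet> a0}"
    by (intro hull_minimal) (auto simp: convex_halfspace_le)
  then have face: "(convex hull A \<inter> {x. u \<bullet> x = u \<bullet> a0}) face_of convex hull A"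
    by (intro face_of_Int_supporting_hyperplane_le) auto
  have AF: "A \<inter> (convex hull A \<inter> {x. u \<bullet> x = u \<bullet> a0}) = S"
    using uS uN SA hull_inc[of _ A convex] by fastforce
  then have nz': "(\<Sum>a\<in>S. c a * of_real (exp (a \<bullet> z))) \<noteq> 0"
    using nz[OF face, of z] a0 by auto
  \<comment> \<open>The limit of \<open>q / Z\<close> along the subsequence is found in two ways: it
    is 0 by the choice of \<open>y\<close>, and by \<open>lz\<close> it is a positive multiple of
    the face sum at \<open>z\<close>, which is nonzero by \<open>nz'\<close>.\<close>
  have "(\<lambda>k. \<Sum>a\<in>A. c a * of_real (w a (r k))) \<longlonglongrightarrow> (\<Sum>a\<in>A. c a * of_real (l a))"
    by (intro tendsto_intros wl)
  moreover have "(\<lambda>k. \<Sum>a\<in>A. c a * of_real (w a (r k))) \<longlonglongrightarrow> 0"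
  proof (rule LIMSEQ_norm_0)
    fix k
    have "(\<Sum>a\<in>A. c a * of_real (w a (r k))) = q (y (r k)) / of_real (Z (y (r k)))"
      by (simp add: q_def w_def sum_divide_distrib)
    then have "norm (\<Sum>a\<in>A. c a * of_real (w a (r k))) = norm (q (y (r k))) / Z (y (r k))"
      using Zpos[of "y (r k)"] by (simp add: norm_divide)
    also have "\<dots> < 1 / real (Suc (r k))"
      using y[of "r k"] Zpos[of "y (r k)"] by (simp add: divide_less_eq)
    also have "\<dots> \<le> 1 / real (Suc k)"
      using seq_suble[OF r(1), of k] by (intro divide_left_mono) auto
    finally show "norm (\<Sum>a\<in>A. c a * of_real (w a (r k))) < 1 / real (Suc k)" .
  qed
  ultimately have "(\<Sum>a\<in>A. c a * of_real (l a)) = 0" using LIMSEQ_unique by blast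
  moreover have "(\<Sum>a\<in>A. c a * of_real (l a)) = (\<Sum>a\<in>S. c a * of_real (l a))"
    using l0 SA fin by (intro sum.mono_neutral_right) (force simp: S_def)+
  moreover have "\<dots> = of_real (l a0 * exp (- (a0 \<bullet> z))) * (\<Sum>a\<in>S. c a * of_real (exp (a \<bullet> z)))"
    unfolding sum_distrib_left
    by (intro sum.cong refl) (simp add: lz inner_diff_left exp_diff exp_minus divide_inverse)
  ultimately show False using nz' la0 by simp
qed

section \<open>Sums over multi-indices and termwise integration\<close>

text \<open>Nonnegative terms are summable once their finite sums are bounded. A finite set of
  choice functions lies in the box of its coordinate projections, over which the sum of products
  factors.\<close>

lemma abs_summable_prod_PiE:
  fixes f :: "'a \<Rightarrow> 'b \<Rightarrow> 'c::{real_normed_div_algebra, comm_semiring_1}"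
  assumes "finite A" "\<And>x. x \<in> A \<Longrightarrow> (\<lambda>y. norm (f x y)) summable_on B x"
  shows "(\<lambda>g. norm (\<Prod>x\<in>A. f x (g x))) summable_on PiE A B"
proof (rule nonneg_bdd_above_summable_on)
  show "bdd_above (sum (\<lambda>g. norm (\<Prod>x\<in>A. f x (g x))) ` {F. F \<subseteq> PiE A B \<and> finite F})"
  proof (rule bdd_aboveI2)
    fix F assume F: "F \<in> {F. F \<subseteq> PiE A B \<and> finite F}"
    define C where "C x = (\<lambda>g. g x) ` F" for x
    have C: "finite (C x)" for x using F by (simp add: C_def)
    have CB: "C x \<subseteq> B x" if "x \<in> A" for x using F that by (auto simp: C_def PiE_def)
    have "F \<subseteq> PiE A C" using F by (auto simp: C_def PiE_def)
    then have "(\<Sum>g\<in>F. norm (\<Prod>x\<in>A. f x (g x))) \<le> (\<Sum>g\<in>PiE A C. norm (\<Prod>x\<in>A. f x (g x)))"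
      using C assms(1) by (intro sum_mono2 finite_PiE) auto
    also have "\<dots> = (\<Prod>x\<in>A. \<Sum>y\<in>C x. norm (f x y))"
      using C assms(1) by (simp add: prod_sum_PiE prod_norm)
    also have "\<dots> \<le> (\<Prod>x\<in>A. infsum (\<lambda>y. norm (f x y)) (B x))"
      using C CB assms(2) by (intro prod_mono) (auto intro!: sum_nonneg finite_sum_le_infsum)
    finally show "(\<Sum>g\<in>F. norm (\<Prod>x\<in>A. f x (g x))) \<le> (\<Prod>x\<in>A. infsum (\<lambda>y. norm (f x y)) (B x))" .
  qed
qed auto

text \<open>Absolute summability lets the sum over functions factor into the sums over the
  coordinates; the bijection \<open>vec_nth\<close> carries this over to vectors.\<close>

lemma has_sum_prod_vec:
  fixes f :: "'n::finite \<Rightarrow> 'b \<Rightarrow> complex"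
  assumes "\<And>i. (\<lambda>y. norm (f i y)) summable_on UNIV" "\<And>i. (f i has_sum S i) UNIV"
  shows "((\<lambda>\<alpha>::'b^'n. \<Prod>i\<in>UNIV. f i (\<alpha> $ i)) has_sum (\<Prod>i\<in>UNIV. S i)) UNIV"
proof -
  have "(\<lambda>g. \<Prod>i\<in>UNIV. f i (g i)) summable_on PiE UNIV (\<lambda>_. UNIV)"
    by (rule abs_summable_summable[OF abs_summable_prod_PiE]) (use assms in auto)
  moreover have "infsum (\<lambda>g. \<Prod>i\<in>UNIV. f i (g i)) (PiE UNIV (\<lambda>_. UNIV)) = (\<Prod>i\<in>UNIV. S i)"
    using assms by (subst infsum_prod_PiE_abs) (auto simp: infsumI[OF assms(2)])
  ultimately have "((\<lambda>g. \<Prod>i\<in>UNIV. f i (g i)) has_sum (\<Prod>i\<in>UNIV. S i)) (UNIV :: ('n \<Rightarrow> 'b) set)"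
    using has_sum_infsum by (metis PiE_UNIV_domain Pi_UNIV UNIV_def)
  moreover have "bij_betw vec_nth (UNIV::('b^'n) set) UNIV"
    by (rule bij_betwI[of _ _ _ vec_lambda]) auto
  ultimately show ?thesis
    using has_sum_reindex_bij_betw[of vec_nth UNIV UNIV "\<lambda>g. \<Prod>i\<in>UNIV. f i (g i)"] by simp
qed

lemma has_sum_exp_vec:
  fixes u :: "'n::finite \<Rightarrow> complex"
  shows "((\<lambda>\<alpha>::nat^'n. \<Prod>i\<in>UNIV. u i ^ (\<alpha> $ i) / fact (\<alpha> $ i)) has_sum (\<Prod>i\<in>UNIV. exp (u i))) UNIV"
proof (rule has_sum_prod_vec)
  fix i
  have sums: "(\<lambda>n. u i ^ n / fact n) sums exp (u i)"
    using exp_converges[of "u i"] by (simp add: scaleR_conv_of_real divide_inverse mult.commute)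
  have "summable (\<lambda>n. norm (u i ^ n / fact n))"
    using summable_norm_exp[of "u i"] by (simp add: norm_divide norm_mult norm_power norm_inverse divide_inverse mult.commute)
  then show "(\<lambda>n. norm (u i ^ n / fact n)) summable_on UNIV"
    "((\<lambda>n. u i ^ n / fact n) has_sum exp (u i)) UNIV"
    using sums by (auto intro: norm_summable_imp_has_sum norm_summable_imp_summable_on)
qed

text \<open>Since \<open>norm (z i) \<le> r\<close>, the integrable function in \<open>int\<close>
  dominates every finite sum of norms of terms in the expansion of the exponentials. This one bound
  justifies exchanging sum and integral, and gives unconditional convergence.\<close>

lemma integral_prod_exp_has_sum:
  fixes G :: "'a \<Rightarrow> complex" and u :: "'n::finite \<Rightarrow> 'a \<Rightarrow> real" and z :: "'n \<Rightarrow> complex"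
  assumes [measurable]: "G \<in> borel_measurable M" "\<And>i. u i \<in> borel_measurable M"
    and int: "integrable M (\<lambda>x. norm (G x) * (\<Prod>i\<in>UNIV. exp (r * \<bar>u i x\<bar>)))"
    and z: "\<And>i. norm (z i) \<le> r"
  shows "((\<lambda>\<alpha>::nat^'n. (LINT x|M. G x * (\<Prod>i\<in>UNIV. of_real (u i x ^ (\<alpha> $ i) / fact (\<alpha> $ i)))) *
           (\<Prod>i\<in>UNIV. z i ^ (\<alpha> $ i)))
         has_sum (LINT x|M. G x * (\<Prod>i\<in>UNIV. exp (z i * of_real (u i x))))) UNIV"
proof -
  define f where "f \<alpha> x = G x * (\<Prod>i\<in>UNIV. (z i * of_real (u i x)) ^ (\<alpha> $ i) / fact (\<alpha> $ i))"
    for \<alpha> :: "nat^'n" and x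
  define H where "H x = norm (G x) * (\<Prod>i\<in>UNIV. exp (r * \<bar>u i x\<bar>))" for x
  have [measurable]: "f \<alpha> \<in> borel_measurable M" for \<alpha>
    unfolding f_def by measurable
  have fin_le: "(\<Sum>\<alpha>\<in>N. norm (f \<alpha> x)) \<le> H x" if "finite N" for N x
  proof -
    \<comment> \<open>Up to the factor \<open>norm (G x)\<close>, the norms of the terms form the
      exponential product series at the real numbers \<open>v i\<close>.
      \<open>has_sum_exp_vec\<close> is complex, hence the detour through
      \<open>complex_of_real\<close>.\<close>
    define v where "v i = norm (z i) * \<bar>u i x\<bar>" for i
    have "((\<lambda>\<alpha>::nat^'n. \<Prod>i\<in>UNIV. complex_of_real (v i) ^ (\<alpha> $ i) / fact (\<alpha> $ i)) has_sum
        (\<Prod>i\<in>UNIV. exp (complex_of_real (v i)))) UNIV" by (rule has_sum_exp_vec)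
    then have "((\<lambda>\<alpha>::nat^'n. complex_of_real (\<Prod>i\<in>UNIV. v i ^ (\<alpha> $ i) / fact (\<alpha> $ i))) has_sum
        complex_of_real (\<Prod>i\<in>UNIV. exp (v i))) UNIV"
      by (simp add: exp_of_real)
    then have hs: "((\<lambda>\<alpha>::nat^'n. \<Prod>i\<in>UNIV. v i ^ (\<alpha> $ i) / fact (\<alpha> $ i)) has_sum
        (\<Prod>i\<in>UNIV. exp (v i))) UNIV"
      by (simp only: has_sum_of_real_iff)
    have v0: "v i \<ge> 0" for i by (simp add: v_def)
    have "(\<Sum>\<alpha>\<in>N. norm (f \<alpha> x)) = norm (G x) * (\<Sum>\<alpha>\<in>N. \<Prod>i\<in>UNIV. v i ^ (\<alpha> $ i) / fact (\<alpha> $ i))"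
      by (simp add: f_def v_def norm_mult sum_distrib_left norm_divide norm_power power_mult_distrib prod_norm[symmetric])
    also have "\<dots> \<le> norm (G x) * (\<Prod>i\<in>UNIV. exp (v i))"
      using hs that v0 by (intro mult_left_mono has_sum_mono2[OF has_sum_finite hs])
        (auto intro!: prod_nonneg)
    also have "\<dots> \<le> H x"
      unfolding H_def v_def using z by (intro mult_left_mono prod_mono) (auto intro!: mult_right_mono)
    finally show ?thesis .
  qed
  have intH: "integrable M H" using int unfolding H_def .
  have "norm (f \<alpha> x) \<le> H x" for \<alpha> x using fin_le[of "{\<alpha>}" x] by simp
  then have intf: "integrable M (f \<alpha>)" for \<alpha>
    by (intro Bochner_Integration.integrable_bound[OF intH]) (auto intro: order_trans[OF _ abs_ge_self])
  \<comment> \<open>Constant vectors already give infinitely many multi-indices, so these can be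
    enumerated bijectively by the natural numbers and theorems on series apply.\<close>
  have inf: "infinite (UNIV :: (nat^'n) set)"
  proof -
    have "inj (\<lambda>n::nat. (\<chi> i. n) :: nat^'n)" by (auto simp: inj_def vec_eq_iff)
    then show ?thesis using infinite_UNIV_nat finite_imageD finite_subset by (metis subset_UNIV)
  qed
  obtain e :: "nat \<Rightarrow> nat^'n" where e: "bij_betw e UNIV UNIV"
    using bij_betw_from_nat_into[OF countableI_type inf] by blast
  have hsf: "((\<lambda>\<alpha>. f \<alpha> x) has_sum G x * (\<Prod>i\<in>UNIV. exp (z i * of_real (u i x)))) UNIV" for x
    unfolding f_def by (intro has_sum_cmult_right has_sum_exp_vec)
  \<comment> \<open>As \<open>e\<close> is injective, partial sums along the enumeration are sums
    over finite sets of multi-indices; the bound \<open>H\<close> applies to them, here after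
    integration and in \<open>ps\<close> pointwise.\<close>
  have sm: "summable (\<lambda>n. LINT x|M. norm (f (e n) x))"
  proof (rule bounded_imp_summable)
    fix n
    have "(\<Sum>k\<le>n. LINT x|M. norm (f (e k) x)) = (LINT x|M. (\<Sum>k\<le>n. norm (f (e k) x)))"
      using intf by simp
    also have "\<dots> \<le> (LINT x|M. H x)"
    proof (intro integral_mono intH Bochner_Integration.integrable_sum integrable_norm intf)
      fix x
      have "(\<Sum>k\<le>n. norm (f (e k) x)) = (\<Sum>\<alpha>\<in>e ` {..n}. norm (f \<alpha> x))"
        using e by (subst sum.reindex) (auto simp: bij_betw_def inj_on_def)
      then show "(\<Sum>k\<le>n. norm (f (e k) x)) \<le> H x" using fin_le[of "e ` {..n}" x] by simp
    qed
    finally show "(\<Sum>k\<le>n. LINT x|M. norm (f (e k) x)) \<le> (LINT x|M. H x)" .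
  qed simp
  have ps: "summable (\<lambda>n. norm (f (e n) x))" for x
  proof (rule bounded_imp_summable)
    fix n
    have "(\<Sum>k\<le>n. norm (f (e k) x)) = (\<Sum>\<alpha>\<in>e ` {..n}. norm (f \<alpha> x))"
      using e by (subst sum.reindex) (auto simp: bij_betw_def inj_on_def)
    then show "(\<Sum>k\<le>n. norm (f (e k) x)) \<le> H x" using fin_le[of "e ` {..n}" x] by simp
  qed simp
  have suminf: "suminf (\<lambda>n. f (e n) x) = G x * (\<Prod>i\<in>UNIV. exp (z i * of_real (u i x)))" for x
  proof -
    have "((\<lambda>n. f (e n) x) has_sum G x * (\<Prod>i\<in>UNIV. exp (z i * of_real (u i x)))) UNIV"
      using hsf[of x] has_sum_reindex_bij_betw[OF e, of "\<lambda>\<alpha>. f \<alpha> x"] by simp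
    from sums_unique[OF has_sum_imp_sums[OF this]] show ?thesis ..
  qed
  have "(\<lambda>n. LINT x|M. f (e n) x) sums (LINT x|M. suminf (\<lambda>n. f (e n) x))"
    using intf ps sm by (intro sums_integral) auto
  moreover have "summable (\<lambda>n. norm (LINT x|M. f (e n) x))"
    by (rule summable_comparison_test'[OF sm]) (simp add: integral_norm_bound)
  ultimately have "((\<lambda>n. LINT x|M. f (e n) x) has_sum (LINT x|M. G x * (\<Prod>i\<in>UNIV. exp (z i * of_real (u i x))))) UNIV"
    using suminf by (intro norm_summable_imp_has_sum) auto
  then have "((\<lambda>\<alpha>. LINT x|M. f \<alpha> x) has_sum (LINT x|M. G x * (\<Prod>i\<in>UNIV. exp (z i * of_real (u i x))))) UNIV"
    using has_sum_reindex_bij_betw[OF e, of "\<lambda>\<alpha>. LINT x|M. f \<alpha> x"] by simp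
  moreover have "(LINT x|M. f \<alpha> x) = (LINT x|M. G x * (\<Prod>i\<in>UNIV. of_real (u i x ^ (\<alpha> $ i) / fact (\<alpha> $ i)))) *
           (\<Prod>i\<in>UNIV. z i ^ (\<alpha> $ i))" for \<alpha>
    unfolding f_def
    by (subst integral_mult_left_zero[symmetric])
       (simp add: power_mult_distrib prod.distrib prod_dividef mult_ac)
  ultimately show ?thesis by simp
qed

section \<open>Integrable majorants of product form\<close>

text \<open>By Tonelli the integral of the product is the product of the one-dimensional
  integrals.\<close>

lemma integrable_prod_cart:
  fixes g :: "'n::finite \<Rightarrow> real \<Rightarrow> real"
  assumes int: "\<And>i. integrable lborel (g i)" and nn: "\<And>i t. 0 \<le> g i t"
  shows "integrable lborel (\<lambda>x::real^'n. \<Prod>i\<in>UNIV. g i (x $ i))"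
proof -
  have [measurable]: "g i \<in> borel_measurable borel" for i
    using borel_measurable_integrable[OF int[of i]] by simp
  have inj: "inj (\<lambda>i::'n. axis i (1::real))" by (auto simp: inj_def axis_eq_axis)
  have Basis: "(Basis :: (real^'n) set) = range (\<lambda>i. axis i 1)" by (auto simp: Basis_vec_def)
  \<comment> \<open>The product formula for \<open>lborel\<close> runs over \<open>Basis\<close>, so
    the factors are relabelled by the unit vectors \<open>axis i 1\<close>.\<close>
  define f where "f b t = g (inv (\<lambda>i. axis i (1::real)) b) t" for b :: "real^'n" and t
  have f: "f (axis i 1) = g i" for i by (simp add: f_def fun_eq_iff inv_f_f[OF inj])
  have [measurable]: "f b \<in> borel_measurable borel" for b unfolding f_def by measurable
  have "(\<Prod>i\<in>UNIV. ennreal (g i (x $ i))) = (\<Prod>b\<in>Basis. ennreal (f b (x \<bullet> b)))" for x :: "real^'n"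
    unfolding Basis by (subst prod.reindex[OF inj]) (simp add: f inner_axis)
  then have "(\<integral>\<^sup>+x. ennreal (norm (\<Prod>i\<in>UNIV. g i (x $ i))) \<partial>(lborel::(real^'n) measure))
      = (\<integral>\<^sup>+x. (\<Prod>b\<in>Basis. ennreal (f b (x \<bullet> b))) \<partial>(lborel::(real^'n) measure))"
    using nn by (simp add: prod_ennreal abs_of_nonneg prod_nonneg)
  also have "\<dots> = (\<Prod>b\<in>(Basis :: (real^'n) set). \<integral>\<^sup>+t. ennreal (f b t) \<partial>lborel)"
    by (rule nn_integral_lborel_prod) auto
  also have "\<dots> < \<infinity>"
  proof -
    have "(\<integral>\<^sup>+t. ennreal (f b t) \<partial>lborel) = ennreal (LINT t|lborel. f b t)" for b
      using nn int unfolding f_def by (intro nn_integral_eq_integral) auto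
    then show ?thesis
      using nn by (simp add: prod_ennreal integral_nonneg f_def)
  qed
  finally show ?thesis by (intro integrableI_bounded) measurable
qed

text \<open>The value 0 for \<open>t \<le> 0\<close> permits integration over the whole space before
  restricting to the orthant. For \<open>a > 0\<close> the first power is integrable at 0; the
  exponent -2 is a convenient choice below -1 at infinity.\<close>

definition mellin_majorant :: "real \<Rightarrow> real \<Rightarrow> real" where
  "mellin_majorant a t = (if t \<le> 0 then 0 else if t \<le> 1 then t powr (a - 1) else t powr (-2))"

lemma mellin_majorant_nonneg: "0 \<le> mellin_majorant a t"
  by (simp add: mellin_majorant_def)

lemma integrable_mellin_majorant:
  assumes "a > 0"
  shows "integrable lborel (mellin_majorant a)"
proof -
  have [measurable]: "mellin_majorant a \<in> borel_measurable borel"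
    unfolding mellin_majorant_def by measurable
  have "(mellin_majorant a has_integral 1 / a) {0..1}"
    by (rule has_integral_spike_finite[of "{0}" _ _ "\<lambda>t. t powr (a - 1)"])
       (use has_integral_powr_from_0[of "a - 1" 1] assms in \<open>auto simp: mellin_majorant_def\<close>)
  moreover have "(mellin_majorant a has_integral 1) {1..}"
    by (rule has_integral_spike_finite[of "{1}" _ _ "\<lambda>t. t powr (-2)"])
       (use has_integral_powr_to_inf[of "-2" 1] in \<open>auto simp: mellin_majorant_def\<close>)
  ultimately have "(mellin_majorant a has_integral (1 / a + 1)) ({0..1} \<union> {1..})"
    by (rule has_integral_Un) (simp add: negligible_subset[of "{1}"] Int_atLeastAtMostR1)
  then have "(mellin_majorant a has_integral (1 / a + 1)) UNIV"
    by (rule has_integral_on_superset) (auto simp: mellin_majorant_def)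
  then have "(\<integral>\<^sup>+t. ennreal (mellin_majorant a t) \<partial>lborel) = ennreal (1 / a + 1)"
    using mellin_majorant_nonneg by (intro nn_integral_has_integral_lborel) auto
  then show ?thesis using mellin_majorant_nonneg by (intro integrableI_nonneg) auto
qed

text \<open>The exponential is \<open>t powr (- r)\<close> up to 1 and \<open>t powr r\<close>
  beyond. The factor \<open>max 1 t ^ m\<close> pays for the growth at infinity and is later
  compensated by the decay of \<open>\<phi>\<close>.\<close>

lemma powr_exp_abs_ln_le_majorant:
  assumes "t > 0" "r \<ge> 0" "w + r + 1 \<le> real m"
  shows "t powr (w - 1) * exp (r * \<bar>ln t\<bar>) \<le> mellin_majorant (w - r) t * max 1 t ^ m"
proof (cases "t \<le> 1")
  case True
  then have "exp (r * \<bar>ln t\<bar>) = t powr (- r)"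
    using assms by (simp add: powr_def)
  then show ?thesis using True assms
    by (simp add: mellin_majorant_def max_def flip: powr_add) (simp add: algebra_simps)
next
  case False
  then have "t powr (w - 1) * exp (r * \<bar>ln t\<bar>) = t powr (w - 1 + r)"
    using assms by (simp add: powr_def algebra_simps flip: exp_add)
  \<comment> \<open>The hypothesis on \<open>m\<close> says exactly that
    \<open>w - 1 + r \<le> m - 2\<close>.\<close>
  also have "\<dots> \<le> t powr (-2 + real m)"
    using assms False by (intro powr_mono) auto
  also have "\<dots> = mellin_majorant (w - r) t * max 1 t ^ m"
    using False assms powr_add[of t "-2" "real m"]
    by (simp add: mellin_majorant_def max_def powr_realpow)
  finally show ?thesis .
qed

text \<open>At each point the product of the \<open>max\<close> factors is a monomial in just the
  coordinates exceeding 1. Only finitely many sets of coordinates occur, so the bounds for the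
  individual monomials can be added.\<close>

lemma rapidly_decreasing_bound:
  fixes \<phi> :: "real^'n::finite \<Rightarrow> real"
  assumes bdd: "bounded (\<phi> ` nonneg_orthant)" and rd: "rapidly_decreasing \<phi>"
  obtains C where "C \<ge> 0" "\<And>x. x \<in> nonneg_orthant \<Longrightarrow> (\<Prod>i\<in>UNIV. max 1 (x $ i) ^ m) * \<bar>\<phi> x\<bar> \<le> C"
proof -
  obtain B where B: "\<And>x. x \<in> nonneg_orthant \<Longrightarrow> \<bar>\<phi> x\<bar> \<le> B"
    using bdd unfolding bounded_iff by auto
  have B0: "B \<ge> 0" using B[of 0] by (simp add: nonneg_orthant_def)
  \<comment> \<open>For fixed \<open>S\<close>, rapid decrease with exponent \<open>m\<close> on
    \<open>S\<close> and 0 elsewhere gives the bound 1 for norms from some \<open>R\<close> on;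
    below \<open>R\<close> all coordinates and \<open>\<phi>\<close> are bounded.\<close>
  have "\<exists>C\<ge>0. \<forall>x\<in>nonneg_orthant. (\<Prod>i\<in>S. (x $ i) ^ m) * \<bar>\<phi> x\<bar> \<le> C" for S :: "'n set"
  proof -
    have mono: "(\<Prod>i\<in>UNIV. (x $ i) powi ((\<chi> i. if i \<in> S then int m else 0) $ i)) = (\<Prod>i\<in>S. (x $ i) ^ m)"
      for x :: "real^'n"
      by (rule prod.mono_neutral_cong_right) auto
    have "((\<lambda>x. (\<Prod>i\<in>UNIV. (x $ i) powi ((\<chi> i. if i \<in> S then int m else 0) $ i)) * \<phi> x) \<longlongrightarrow> 0)
          (inf at_infinity (principal nonneg_orthant))"
      using rd unfolding rapidly_decreasing_def by blast
    then have "\<forall>\<^sub>F x in inf at_infinity (principal nonneg_orthant). dist ((\<Prod>i\<in>S. (x $ i) ^ m) * \<phi> x) 0 < 1"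
      unfolding mono by (rule tendstoD) simp
    then obtain R where R: "\<And>x. R \<le> norm x \<Longrightarrow> x \<in> nonneg_orthant \<Longrightarrow> \<bar>(\<Prod>i\<in>S. (x $ i) ^ m) * \<phi> x\<bar> < 1"
      by (auto simp: eventually_inf_principal eventually_at_infinity)
    define C where "C = (\<Prod>i\<in>S. (max 1 R) ^ m) * B"
    have "C \<ge> 0" unfolding C_def using B0 by (intro mult_nonneg_nonneg prod_nonneg) auto
    have "(\<Prod>i\<in>S. (x $ i) ^ m) * \<bar>\<phi> x\<bar> \<le> max 1 C" if x: "x \<in> nonneg_orthant" for x
    proof (cases "R \<le> norm x")
      case True
      have "(\<Prod>i\<in>S. (x $ i) ^ m) \<ge> 0" using x by (auto intro!: prod_nonneg simp: nonneg_orthant_def)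
      then show ?thesis using R[OF True x] by (simp add: abs_mult)
    next
      case False
      have "(\<Prod>i\<in>S. (x $ i) ^ m) * \<bar>\<phi> x\<bar> \<le> C" unfolding C_def
      proof (intro mult_mono B x prod_mono conjI)
        fix i
        have "x $ i \<le> max 1 R" using False component_le_norm_cart[of x i] by linarith
        then show "x $ i ^ m \<le> max 1 R ^ m" using x by (intro power_mono) (auto simp: nonneg_orthant_def)
      qed (use x in \<open>auto intro!: prod_nonneg simp: nonneg_orthant_def\<close>)
      then show ?thesis by simp
    qed
    then show ?thesis by (intro exI[of _ "max 1 C"]) auto
  qed
  then obtain K where K: "\<And>S. K S \<ge> 0"
    "\<And>S x. x \<in> nonneg_orthant \<Longrightarrow> (\<Prod>i\<in>S. (x $ i) ^ m) * \<bar>\<phi> x\<bar> \<le> K S" by metis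
  show thesis
  proof
    show "0 \<le> (\<Sum>S\<in>UNIV. K S)" using K by (simp add: sum_nonneg)
    fix x :: "real^'n" assume x: "x \<in> nonneg_orthant"
    have "(\<Prod>i\<in>UNIV. max 1 (x $ i) ^ m) = (\<Prod>i\<in>{i. x $ i > 1}. (x $ i) ^ m)"
      by (rule prod.mono_neutral_cong_right) (auto simp: max_def)
    then have "(\<Prod>i\<in>UNIV. max 1 (x $ i) ^ m) * \<bar>\<phi> x\<bar> \<le> K {i. x $ i > 1}"
      using K(2)[OF x] by metis
    also have "\<dots> \<le> (\<Sum>S\<in>UNIV. K S)" using K by (intro member_le_sum) auto
    finally show "(\<Prod>i\<in>UNIV. max 1 (x $ i) ^ m) * \<bar>\<phi> x\<bar> \<le> (\<Sum>S\<in>UNIV. K S)" .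
  qed
qed

section \<open>Polynomials on the positive orthant in logarithmic coordinates\<close>

lemma inj_exponent_vec: "inj exponent_vec"
  by (auto simp: inj_def exponent_vec_def vec_eq_iff)

lemma exp_inner_ln:
  assumes "x \<in> pos_orthant"
  shows "exp (v \<bullet> (\<chi> i. ln (x $ i))) = (\<Prod>i\<in>UNIV. x $ i powr (v $ i))"
  using assms by (simp add: inner_vec_def exp_sum powr_def pos_orthant_def less_imp_neq[symmetric])

lemma eval_poly_exp:
  assumes "x \<in> pos_orthant"
  shows "eval_poly p (cvec x) = (\<Sum>\<alpha>\<in>Poly_Mapping.keys p.
    Poly_Mapping.lookup p \<alpha> * of_real (exp (exponent_vec \<alpha> \<bullet> (\<chi> i. ln (x $ i)))))"
  using assms unfolding eval_poly_def exp_inner_ln[OF assms]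
  by (simp add: cvec_def exponent_vec_def pos_orthant_def powr_realpow)

lemma lookup_truncated_poly:
  "Poly_Mapping.lookup (truncated_poly \<Gamma> p) \<beta> =
    (if exponent_vec \<beta> \<in> \<Gamma> then Poly_Mapping.lookup p \<beta> else 0)"
proof -
  have "Poly_Mapping.lookup (truncated_poly \<Gamma> p) \<beta> =
    (\<Sum>\<alpha> | \<alpha> \<in> Poly_Mapping.keys p \<and> exponent_vec \<alpha> \<in> \<Gamma>.
       if \<alpha> = \<beta> then Poly_Mapping.lookup p \<alpha> else 0)"
    by (simp add: truncated_poly_def lookup_sum lookup_single when_def)
  then show ?thesis by (auto simp: in_keys_iff)
qed

lemma keys_truncated_poly:
  "Poly_Mapping.keys (truncated_poly \<Gamma> p) = {\<alpha> \<in> Poly_Mapping.keys p. exponent_vec \<alpha> \<in> \<Gamma>}"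
  by (auto simp: in_keys_iff lookup_truncated_poly split: if_splits)

text \<open>In logarithmic coordinates \<open>p\<close> is an exponential sum and is bounded below
  by a multiple of the sum of its monomials. That a monomial is at most this sum is a half-space
  condition on its exponent, so it passes to the convex hull and one \<open>\<delta>\<close> serves
  all \<open>v\<close>.\<close>

lemma eval_poly_lower_bound:
  fixes p :: "'n::finite polynomial"
  assumes nv: "completely_nonvanishing_on p (cvec ` pos_orthant)"
  obtains \<delta> where "\<delta> > 0"
    "\<And>x v. x \<in> pos_orthant \<Longrightarrow> v \<in> newton_polytope p \<Longrightarrow>
      \<delta> * (\<Prod>i\<in>UNIV. x $ i powr (v $ i)) \<le> norm (eval_poly p (cvec x))"
proof -
  define K where "K = Poly_Mapping.keys p"
  define A where "A = exponent_vec ` K"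
  \<comment> \<open>Coefficients indexed by real vectors; \<open>inv\<close> is meaningful on
    \<open>A\<close> because \<open>exponent_vec\<close> is injective.\<close>
  define c where "c a = Poly_Mapping.lookup p (inv exponent_vec a)" for a
  have c: "c (exponent_vec \<alpha>) = Poly_Mapping.lookup p \<alpha>" for \<alpha>
    by (simp add: c_def inv_f_f[OF inj_exponent_vec])
  have N: "newton_polytope p = convex hull A" by (simp add: newton_polytope_def A_def K_def)
  have nz: "(\<Sum>a\<in>A \<inter> F. c a * of_real (exp (a \<bullet> y))) \<noteq> 0"
    if F: "F face_of convex hull A" "F \<noteq> {}" for F y
  proof -
    \<comment> \<open>The point with logarithm \<open>y\<close>: there the truncated polynomial of
      \<open>F\<close> takes the value of the exponential sum over
      \<open>A \<inter> F\<close>.\<close>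
    define x :: "real^'n" where "x = (\<chi> i. exp (y $ i))"
    have x: "x \<in> pos_orthant" by (simp add: x_def pos_orthant_def)
    have y: "(\<chi> i. ln (x $ i)) = y" by (simp add: x_def vec_eq_iff)
    have "eval_poly (truncated_poly F p) (cvec x) \<noteq> 0"
      using nv F x unfolding completely_nonvanishing_on_def N by blast
    moreover have "A \<inter> F = exponent_vec ` {\<alpha> \<in> K. exponent_vec \<alpha> \<in> F}" by (auto simp: A_def)
    ultimately show ?thesis
      unfolding eval_poly_exp[OF x] y keys_truncated_poly
      by (simp add: sum.reindex inj_on_subset[OF inj_exponent_vec] c K_def lookup_truncated_poly)
  qed
  have "A \<noteq> {}"
  proof
    assume "A = {}"
    then have "eval_poly p (cvec 1) = 0" by (simp add: A_def K_def eval_poly_def)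
    moreover have "(1 :: real^'n) \<in> pos_orthant" by (simp add: pos_orthant_def)
    ultimately show False using nv unfolding completely_nonvanishing_on_def by blast
  qed
  moreover have "finite A" by (simp add: A_def K_def)
  ultimately obtain \<delta> where \<delta>: "\<delta> > 0"
    "\<And>y. \<delta> * (\<Sum>a\<in>A. exp (a \<bullet> y)) \<le> norm (\<Sum>a\<in>A. c a * of_real (exp (a \<bullet> y)))"
    using exponential_sum_lower_bound[of A c] nz by blast
  show thesis
  proof
    show "\<delta> > 0" by fact
    fix x v :: "real^'n" assume x: "x \<in> pos_orthant" and v: "v \<in> newton_polytope p"
    define y where "y = (\<chi> i. ln (x $ i))"
    define Z where "Z = (\<Sum>a\<in>A. exp (a \<bullet> y))"
    have aZ: "exp (a \<bullet> y) \<le> Z" if "a \<in> A" for a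
      unfolding Z_def using that \<open>finite A\<close> by (intro member_le_sum) auto
    have "Z > 0" unfolding Z_def using \<open>finite A\<close> \<open>A \<noteq> {}\<close> by (intro sum_pos) auto
    then have "A \<subseteq> {a. y \<bullet> a \<le> ln Z}"
      using aZ by (auto simp: ln_ge_iff inner_commute)
    then have "convex hull A \<subseteq> {a. y \<bullet> a \<le> ln Z}"
      by (intro hull_minimal convex_halfspace_le)
    then have "exp (v \<bullet> y) \<le> Z"
      using v \<open>Z > 0\<close> unfolding N by (auto simp: ln_ge_iff inner_commute)
    then have "\<delta> * (\<Prod>i\<in>UNIV. x $ i powr (v $ i)) \<le> \<delta> * Z"
      using \<open>\<delta> > 0\<close> exp_inner_ln[OF x, of v] by (simp add: y_def)
    also have "\<dots> \<le> norm (\<Sum>a\<in>A. c a * of_real (exp (a \<bullet> y)))"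
      unfolding Z_def by (rule \<delta>)
    also have "(\<Sum>a\<in>A. c a * of_real (exp (a \<bullet> y))) = eval_poly p (cvec x)"
      unfolding eval_poly_exp[OF x] A_def y_def
      by (simp add: sum.reindex inj_on_subset[OF inj_exponent_vec] c K_def)
    finally show "\<delta> * (\<Prod>i\<in>UNIV. x $ i powr (v $ i)) \<le> norm (eval_poly p (cvec x))" .
  qed
qed

section \<open>Measurability and integrability of the Mellin integrand\<close>

lemma open_pos_orthant: "open (pos_orthant :: (real^'n) set)"
proof -
  have "(pos_orthant :: (real^'n) set) = (\<Inter>i. {x. 0 < x $ i})" by (auto simp: pos_orthant_def)
  moreover have "open (\<Inter>i. {x::real^'n. 0 < x $ i})"
    by (intro open_INT) (auto intro!: open_Collect_less continuous_intros)
  ultimately show ?thesis by simp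
qed

lemma pos_orthant_lebesgue: "(pos_orthant :: (real^'n) set) \<in> sets lebesgue"
  using open_pos_orthant by (metis borel_open sets_completionI_sets sets_lborel)

text \<open>Everything but \<open>\<phi>\<close> is continuous on the open orthant: positive bases
  avoid the branch cut of \<open>powr\<close>, and \<open>p\<close> does not vanish.\<close>

lemma mellin_integrand_measurable:
  fixes \<phi> :: "real^'n::finite \<Rightarrow> real"
  assumes phi: "\<phi> \<in> borel_measurable (lebesgue_on nonneg_orthant)"
    and nz: "\<And>x. x \<in> pos_orthant \<Longrightarrow> eval_poly p (cvec x) \<noteq> 0"
  shows "mellin_integrand (\<lambda>x. complex_of_real (\<phi> x) / eval_poly p (cvec x)) s
           \<in> borel_measurable (lebesgue_on pos_orthant)"
proof -
  have [measurable]: "\<phi> \<in> borel_measurable (lebesgue_on pos_orthant)"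
    by (rule measurable_restrict_mono[OF phi])
       (auto simp: pos_orthant_def nonneg_orthant_def less_imp_le)
  have "continuous_on pos_orthant
      (\<lambda>x::real^'n. (\<Prod>i\<in>UNIV. complex_of_real (x $ i) powr (s $ i - 1)) / eval_poly p (cvec x))"
    using nz unfolding eval_poly_def cvec_def
    by (intro continuous_intros) (auto simp: pos_orthant_def less_imp_le less_imp_neq[symmetric])
  then have [measurable]: "(\<lambda>x::real^'n. (\<Prod>i\<in>UNIV. complex_of_real (x $ i) powr (s $ i - 1)) / eval_poly p (cvec x))
      \<in> borel_measurable (lebesgue_on pos_orthant)"
    by (rule continuous_imp_measurable_on_sets_lebesgue[OF _ pos_orthant_lebesgue])
  have "(\<lambda>x. ((\<Prod>i\<in>UNIV. complex_of_real (x $ i) powr (s $ i - 1)) / eval_poly p (cvec x)) * of_real (\<phi> x))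
      \<in> borel_measurable (lebesgue_on pos_orthant)"
    by measurable
  then show ?thesis by (simp add: mellin_integrand_def[abs_def])
qed

text \<open>The exponential factor provides room for the expansion around \<open>s\<close>;
  \<open>r = 0\<close> gives plain absolute convergence. The exponent splits as
  \<open>Re s - 1 = v + (w - 1)\<close>: the part \<open>v\<close> is absorbed by \<open>p\<close>,
  the rest by the majorant and the decay of \<open>\<phi>\<close>.\<close>

lemma integrable_mellin_integrand:
  fixes \<phi> :: "real^'n::finite \<Rightarrow> real"
  assumes phi: "\<phi> \<in> borel_measurable (lebesgue_on nonneg_orthant)"
    and bdd: "bounded (\<phi> ` nonneg_orthant)" and rd: "rapidly_decreasing \<phi>"
    and nv: "completely_nonvanishing_on p (cvec ` pos_orthant)"
    and v: "v \<in> newton_polytope p" and r: "r \<ge> 0" "\<And>i. v $ i + r < Re (s $ i)"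
  shows "integrable (lebesgue_on pos_orthant)
    (\<lambda>x. norm (mellin_integrand (\<lambda>x. complex_of_real (\<phi> x) / eval_poly p (cvec x)) s x) *
         (\<Prod>i\<in>UNIV. exp (r * \<bar>ln (x $ i)\<bar>)))"
    (is "integrable ?M ?F")
proof -
  define w where "w i = Re (s $ i) - v $ i" for i
  \<comment> \<open>One power for all coordinates, large enough for
    \<open>powr_exp_abs_ln_le_majorant\<close>.\<close>
  obtain m :: nat where m: "\<And>i. w i + r + 1 \<le> real m"
  proof -
    obtain m :: nat where "Max (range w) + r + 1 \<le> real m" using real_arch_simple by blast
    moreover have "w i \<le> Max (range w)" for i by (intro Max_ge) auto
    ultimately have "w i + r + 1 \<le> real m" for i by (smt (verit))
    then show thesis by (rule that)
  qed
  obtain C where C: "C \<ge> 0"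
    "\<And>x. x \<in> nonneg_orthant \<Longrightarrow> (\<Prod>i\<in>UNIV. max 1 (x $ i) ^ m) * \<bar>\<phi> x\<bar> \<le> C"
    using rapidly_decreasing_bound[OF bdd rd] by blast
  obtain \<delta> where \<delta>: "\<delta> > 0" "\<And>x v. x \<in> pos_orthant \<Longrightarrow> v \<in> newton_polytope p \<Longrightarrow>
      \<delta> * (\<Prod>i\<in>UNIV. x $ i powr (v $ i)) \<le> norm (eval_poly p (cvec x))"
    using eval_poly_lower_bound[OF nv] by blast
  have nz: "eval_poly p (cvec x) \<noteq> 0" if "x \<in> pos_orthant" for x
    using nv that unfolding completely_nonvanishing_on_def by blast
  \<comment> \<open>\<open>C\<close> comes from the decay of \<open>\<phi>\<close> and
    \<open>1 / \<delta>\<close> from the lower bound on \<open>p\<close>. The strict inequality for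
    \<open>Re (s $ i)\<close> makes \<open>w i - r\<close> positive, as integrability at 0
    demands.\<close>
  define H where "H x = C / \<delta> * (\<Prod>i\<in>UNIV. mellin_majorant (w i - r) (x $ i))" for x :: "real^'n"
  have "integrable lborel H"
    unfolding H_def using r
    by (intro integrable_mult_right integrable_prod_cart integrable_mellin_majorant mellin_majorant_nonneg)
       (simp add: w_def algebra_simps)
  then have "integrable lebesgue H"
    by (simp add: integrable_completion borel_measurable_integrable)
  then have H: "integrable ?M H"
    using integrable_mult_indicator[OF pos_orthant_lebesgue, of H]
    by (subst integrable_restrict_space) (simp_all add: pos_orthant_lebesgue)
  show ?thesis
  proof (rule Bochner_Integration.integrable_bound[OF H])
    have [measurable]: "(\<lambda>x::real^'n. \<Prod>i\<in>UNIV. exp (r * \<bar>ln (x $ i)\<bar>)) \<in> borel_measurable ?M"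
      by (rule continuous_imp_measurable_on_sets_lebesgue[OF _ pos_orthant_lebesgue])
         (auto intro!: continuous_intros simp: pos_orthant_def less_imp_neq[symmetric])
    note [measurable] = mellin_integrand_measurable[OF phi nz]
    show "?F \<in> borel_measurable ?M" by measurable
    have "norm (?F x) \<le> norm (H x)" if x: "x \<in> pos_orthant" for x
    proof -
      have pos: "x $ i > 0" for i using x by (simp add: pos_orthant_def)
      have xn: "x \<in> nonneg_orthant" using pos by (simp add: nonneg_orthant_def less_imp_le)
      \<comment> \<open>The monomial with exponent \<open>v\<close>, to be cancelled against
        \<open>p\<close>.\<close>
      define q where "q = (\<Prod>i\<in>UNIV. x $ i powr (v $ i))"
      have q: "q > 0" unfolding q_def by (intro prod_pos) (simp add: less_imp_neq[OF pos, symmetric])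
      have "norm (\<Prod>i\<in>UNIV. complex_of_real (x $ i) powr (s $ i - 1)) = (\<Prod>i\<in>UNIV. x $ i powr (Re (s $ i) - 1))"
        using pos by (simp add: prod_norm[symmetric] norm_powr_real_powr less_imp_le)
      also have "\<dots> = q * (\<Prod>i\<in>UNIV. x $ i powr (w i - 1))"
        using pos by (simp add: q_def w_def flip: prod.distrib powr_add)
      finally have n1: "norm (\<Prod>i\<in>UNIV. complex_of_real (x $ i) powr (s $ i - 1)) = \<dots>" .
      have "q / norm (eval_poly p (cvec x)) \<le> 1 / \<delta>"
        using \<delta>(2)[OF x v] \<delta>(1) nz[OF x] by (simp add: q_def field_simps)
      moreover have "(\<Prod>i\<in>UNIV. x $ i powr (w i - 1)) * (\<Prod>i\<in>UNIV. exp (r * \<bar>ln (x $ i)\<bar>)) * \<bar>\<phi> x\<bar>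
          \<le> (\<Prod>i\<in>UNIV. mellin_majorant (w i - r) (x $ i)) * C"
      proof -
        have "(\<Prod>i\<in>UNIV. x $ i powr (w i - 1)) * (\<Prod>i\<in>UNIV. exp (r * \<bar>ln (x $ i)\<bar>))
            \<le> (\<Prod>i\<in>UNIV. mellin_majorant (w i - r) (x $ i) * max 1 (x $ i) ^ m)"
          unfolding prod.distrib[symmetric]
          by (intro prod_mono conjI powr_exp_abs_ln_le_majorant pos r(1) m) simp
        from mult_right_mono[OF this abs_ge_zero[of "\<phi> x"]]
        have "(\<Prod>i\<in>UNIV. x $ i powr (w i - 1)) * (\<Prod>i\<in>UNIV. exp (r * \<bar>ln (x $ i)\<bar>)) * \<bar>\<phi> x\<bar>
            \<le> (\<Prod>i\<in>UNIV. mellin_majorant (w i - r) (x $ i)) * ((\<Prod>i\<in>UNIV. max 1 (x $ i) ^ m) * \<bar>\<phi> x\<bar>)"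
          by (simp only: prod.distrib mult.assoc)
        also have "\<dots> \<le> (\<Prod>i\<in>UNIV. mellin_majorant (w i - r) (x $ i)) * C"
          by (intro mult_left_mono C(2)[OF xn] prod_nonneg mellin_majorant_nonneg ballI)
        finally show ?thesis .
      qed
      ultimately have "q / norm (eval_poly p (cvec x)) *
          ((\<Prod>i\<in>UNIV. x $ i powr (w i - 1)) * (\<Prod>i\<in>UNIV. exp (r * \<bar>ln (x $ i)\<bar>)) * \<bar>\<phi> x\<bar>)
          \<le> 1 / \<delta> * ((\<Prod>i\<in>UNIV. mellin_majorant (w i - r) (x $ i)) * C)"
        by (rule mult_mono) (use \<delta>(1) in \<open>auto intro!: mult_nonneg_nonneg prod_nonneg\<close>)
      also have "\<dots> = H x" by (simp add: H_def)
      also have "q / norm (eval_poly p (cvec x)) *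
          ((\<Prod>i\<in>UNIV. x $ i powr (w i - 1)) * (\<Prod>i\<in>UNIV. exp (r * \<bar>ln (x $ i)\<bar>)) * \<bar>\<phi> x\<bar>) = ?F x"
        unfolding mellin_integrand_def norm_mult n1 by (simp add: norm_divide)
      finally have "?F x \<le> H x" .
      moreover have "0 \<le> ?F x" by (intro mult_nonneg_nonneg prod_nonneg) auto
      ultimately show ?thesis by simp
    qed
    then show "AE x in ?M. norm (?F x) \<le> norm (H x)" by (intro AE_I2) (simp add: space_restrict_space)
  qed
qed

section \<open>Convergence and power series of the Mellin transform on the tube\<close>

theorem theorem2p8:
  fixes \<phi> :: "real^'n \<Rightarrow> real" and p :: "'n polynomial"
  assumes "\<phi> \<in> borel_measurable (lebesgue_on nonneg_orthant)"
    and "bounded (\<phi> ` nonneg_orthant)"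
    and "rapidly_decreasing \<phi>"
    and "completely_nonvanishing_on p (cvec ` pos_orthant)"
  shows "(\<forall>s \<in> tube_domain (newton_polytope p + pos_orthant).
            mellin_integrand (\<lambda>x. complex_of_real (\<phi> x) / eval_poly p (cvec x)) s
              absolutely_integrable_on pos_orthant) \<and>
         multi_analytic_on
           (mellin_transform (\<lambda>x. complex_of_real (\<phi> x) / eval_poly p (cvec x)))
           (tube_domain (newton_polytope p + pos_orthant))"
proof -
  define f where "f x = complex_of_real (\<phi> x) / eval_poly p (cvec x)" for x
  define M where "M = lebesgue_on (pos_orthant :: (real^'n) set)"
  have space: "space M = pos_orthant" by (simp add: M_def space_restrict_space)
  have "eval_poly p (cvec x) \<noteq> 0" if "x \<in> pos_orthant" for x
    using assms(4) that unfolding completely_nonvanishing_on_def by blast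
  then have meas: "mellin_integrand f s \<in> borel_measurable M" for s
    unfolding f_def M_def using mellin_integrand_measurable[OF assms(1)] by blast
  have int: "integrable M (\<lambda>x. norm (mellin_integrand f s x) * (\<Prod>i\<in>UNIV. exp (r * \<bar>ln (x $ i)\<bar>)))"
    if "v \<in> newton_polytope p" "r \<ge> 0" "\<And>i. v $ i + r < Re (s $ i)" for v r s
    unfolding f_def M_def using integrable_mellin_integrand[OF assms that] .
  have tube: "\<exists>v r. v \<in> newton_polytope p \<and> r > 0 \<and> (\<forall>i. v $ i + r < Re (s $ i))"
    if s: "s \<in> tube_domain (newton_polytope p + pos_orthant)" for s
  proof -
    obtain v w where vw: "v \<in> newton_polytope p" "w \<in> pos_orthant" "Re_vec s = v + w"
      using s by (auto simp: tube_domain_def set_plus_def)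
    \<comment> \<open>Half of the least coordinate lies strictly between 0 and every
      \<open>w $ i\<close>.\<close>
    define r where "r = Min (range (\<lambda>i. w $ i)) / 2"
    have min0: "Min (range (\<lambda>i. w $ i)) > 0" using vw(2) by (simp add: pos_orthant_def)
    have "Min (range (\<lambda>i. w $ i)) \<le> w $ i" for i by simp
    then have "r < w $ i" for i
      using min0 unfolding r_def by (smt (verit) field_sum_of_halves)
    moreover have "r > 0" using min0 by (simp add: r_def)
    moreover have "Re (s $ i) = v $ i + w $ i" for i
      using arg_cong[OF vw(3), of "\<lambda>x. x $ i"] by (simp add: Re_vec_def)
    ultimately show ?thesis using vw(1) by (intro exI[of _ v] exI[of _ r]) auto
  qed
  have intg: "integrable M (mellin_integrand f s)"
    if s: "s \<in> tube_domain (newton_polytope p + pos_orthant)" for s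
  proof -
    obtain v r where "v \<in> newton_polytope p" "r > 0" "\<And>i. v $ i + r < Re (s $ i)"
      using tube[OF s] by blast
    moreover have "v $ i + 0 < Re (s $ i)" for i using calculation(2) calculation(3)[of i] by linarith
    ultimately have "integrable M (\<lambda>x. norm (mellin_integrand f s x))"
      using int[of v 0 s] by simp
    then show ?thesis by (simp add: integrable_norm_iff[OF meas])
  qed
  have mt: "mellin_transform f s = (LINT x|M. mellin_integrand f s x)" for s
    unfolding mellin_transform_def M_def set_lebesgue_integral_def
    by (subst integral_restrict_space) (simp_all add: pos_orthant_lebesgue)
  have "multi_analytic_on (mellin_transform f) (tube_domain (newton_polytope p + pos_orthant))"
    unfolding multi_analytic_on_def
  proof (intro ballI)
    fix a assume "a \<in> tube_domain (newton_polytope p + pos_orthant)"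
    then obtain v r where v: "v \<in> newton_polytope p" and r: "r > 0" "\<And>i. v $ i + r < Re (a $ i)"
      using tube by blast
    \<comment> \<open>The Taylor coefficients: differentiating a power of \<open>x $ i\<close> in
      its exponent brings down a factor \<open>ln (x $ i)\<close>.\<close>
    define c :: "nat^'n \<Rightarrow> complex" where "c \<alpha> = (LINT x|M. mellin_integrand f a x *
        (\<Prod>i\<in>UNIV. of_real (ln (x $ i) ^ (\<alpha> $ i) / fact (\<alpha> $ i))))" for \<alpha>
    have ln_meas: "(\<lambda>x. ln (x $ i)) \<in> borel_measurable M" for i
      unfolding M_def
      by (rule continuous_imp_measurable_on_sets_lebesgue[OF _ pos_orthant_lebesgue])
         (auto intro!: continuous_intros simp: pos_orthant_def less_imp_neq[symmetric])
    have "((\<lambda>\<alpha>. c \<alpha> * (\<Prod>i\<in>UNIV. (z $ i - a $ i) ^ (\<alpha> $ i))) has_sum mellin_transform f z) UNIV"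
      if z: "z \<in> ball a r" for z
    proof -
      \<comment> \<open>A coordinate is no larger than the vector, so the slack \<open>r\<close> of
        the integrability bound serves the whole ball of radius \<open>r\<close>.\<close>
      have "norm (z $ i - a $ i) \<le> r" for i
        using z Finite_Cartesian_Product.norm_nth_le[of "z - a" i] by (simp add: dist_norm norm_minus_commute)
      then have "((\<lambda>\<alpha>. c \<alpha> * (\<Prod>i\<in>UNIV. (z $ i - a $ i) ^ (\<alpha> $ i))) has_sum
          (LINT x|M. mellin_integrand f a x * (\<Prod>i\<in>UNIV. exp ((z $ i - a $ i) * of_real (ln (x $ i)))))) UNIV"
        unfolding c_def
        using r int[OF v _ r(2)] by (intro integral_prod_exp_has_sum[where r = r] meas ln_meas) auto
      also have "(LINT x|M. mellin_integrand f a x * (\<Prod>i\<in>UNIV. exp ((z $ i - a $ i) * of_real (ln (x $ i)))))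
          = mellin_transform f z"
        unfolding mt
      proof (intro Bochner_Integration.integral_cong refl)
        fix x assume "x \<in> space M"
        then have pos: "x $ i > 0" for i by (simp add: space pos_orthant_def)
        \<comment> \<open>For a positive base the logarithm is real, and the exponential shifts the
          exponent from \<open>a\<close> to \<open>z\<close>.\<close>
        have "complex_of_real (x $ i) powr (a $ i - 1) * exp ((z $ i - a $ i) * of_real (ln (x $ i)))
            = complex_of_real (x $ i) powr (z $ i - 1)" for i
          using pos[of i] by (simp add: powr_def Ln_of_real algebra_simps flip: exp_add)
        then show "mellin_integrand f a x * (\<Prod>i\<in>UNIV. exp ((z $ i - a $ i) * of_real (ln (x $ i))))
            = mellin_integrand f z x"
          by (simp add: mellin_integrand_def mult.commute mult.left_commute flip: prod.distrib)
      qed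
      finally show ?thesis .
    qed
    with r(1) show "\<exists>r>0. \<exists>c. \<forall>z\<in>ball a r.
        ((\<lambda>\<alpha>. c \<alpha> * (\<Prod>i\<in>UNIV. (z $ i - a $ i) ^ (\<alpha> $ i))) has_sum mellin_transform f z) UNIV"
      by blast
  qed
  moreover have "mellin_integrand f s absolutely_integrable_on pos_orthant"
    if s: "s \<in> tube_domain (newton_polytope p + pos_orthant)" for s
    using intg[OF s] unfolding M_def set_integrable_def
    by (subst (asm) integrable_restrict_space) (simp_all add: pos_orthant_lebesgue)
  ultimately show ?thesis unfolding f_def by blast
qed

end
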